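(* Let $n\geq 5$. Every element of the alternating group $A_n$ is a commutator of an element of odd order and an element of order dividing $4$; that is, for every $x\in A_n$ there exist $y,a\in A_n$ such that $x=[y,a]$, the order of $y$ is odd, and the order of $a$ divides $4$.
   Context: For elements $x,y$ of a group, $[x,y]=x^{-1}y^{-1}xy$. $A_n$ is the alternating group on $n$ symbols. *)

theory Defs
  imports "HOL-Algebra.Algebra"
begin

(* The convention is [x, y] = x^-1 y^-1 x y; "derived_set" in HOL-Algebra uses x y x^-1 y^-1. *)
definition commutator :: "('a, 'b) monoid_scheme \<Rightarrow> 'a \<Rightarrow> 'a \<Rightarrow> 'a" where
  "commutator G x y = inv\<^bsub>G\<^esub> x \<otimes>\<^bsub>G\<^esub> inv\<^bsub>G\<^esub> y \<otimes>\<^bsub>G\<^esub> x \<otimes>\<^bsub>G\<^esub> y"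

end

theory Submission
  imports Defs
begin

text \<open>Write \<open>x\<close> as a product of disjoint cycles and solve \<open>x = [y, a]\<close> on small unions of cycles with
  disjoint supports, \<open>y\<close> being a product of odd cycles. The solutions multiply; the only global
  constraint is that the product of the \<open>a\<close>'s be even. The engine is an extension step: if
  \<open>x = [y, a]\<close> and \<open>q, r\<close> are new points, then replacing \<open>y\<close> by \<open>y (p q r)\<close> and \<open>a\<close> by \<open>a (q r)\<close>
  lengthens a cycle of \<open>x\<close> by two and changes the parity of \<open>a\<close>. Starting from a few small
  solutions, every cycle of odd length at least 5, and every pair of cycles of even lengths other
  than 2, 2, is solved with \<open>a\<close> of either parity. For 3-cycles (\<open>a\<close> odd) and pairs of 2-cycles
  (\<open>a\<close> even) the parity is forced, but combining two such pieces that include a 3-cycle, or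
  having two fixed points, frees it again. Only a single 3-cycle with at most one
  fixed point needs an odd \<open>a\<close>, and this is excluded by \<open>n \<ge> 5\<close>.\<close>

section \<open>Commuting permutations and cycles\<close>

lemma permutes_comp_commute:
  assumes "f permutes S" "g permutes T" "S \<inter> T = {}"
  shows "f \<circ> g = g \<circ> f"
proof
  fix z
  consider "z \<in> S" "z \<notin> T" | "z \<in> T" "z \<notin> S" | "z \<notin> S" "z \<notin> T"
    using assms(3) by blast
  then show "(f \<circ> g) z = (g \<circ> f) z"
  proof cases
    case 1
    then have "f z \<notin> T" using permutes_in_image[OF assms(1), of z] assms(3) by blast
    with 1 show ?thesis using permutes_not_in[OF assms(2)] by simp
  next
    case 2
    then have "g z \<notin> S" using permutes_in_image[OF assms(2), of z] assms(3) by blast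
    with 2 show ?thesis using permutes_not_in[OF assms(1)] by simp
  next
    case 3
    then show ?thesis using permutes_not_in[OF assms(1)] permutes_not_in[OF assms(2)] by simp
  qed
qed

lemma funpow_comp_commute:
  fixes f g :: "'a \<Rightarrow> 'a"
  assumes "f \<circ> g = g \<circ> f"
  shows "(f \<circ> g) ^^ n = f ^^ n \<circ> g ^^ n"
proof (induction n)
  case (Suc n)
  have *: "g (f z) = f (g z)" for z using assms by (metis comp_apply)
  have "(f ^^ n) (g z) = g ((f ^^ n) z)" for z by (induction n) (auto simp: *)
  then show ?case using Suc by (simp add: fun_eq_iff *)
qed simp

lemma evenperm_cycle_of_list:
  assumes "distinct cs" "cs \<noteq> []"
  shows "evenperm (cycle_of_list cs) \<longleftrightarrow> odd (length cs)"
  using assms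
proof (induction cs rule: cycle_of_list.induct)
  case (1 i j cs)
  have "evenperm (cycle_of_list (i # j # cs)) \<longleftrightarrow> odd (length (i # j # cs))"
    using evenperm_comp[OF permutation_swap_id permutation_of_cycle, of i j "j # cs"] 1
    by (simp add: evenperm_swap)
  then show ?case .
qed (auto simp: evenperm_id)

lemma cycle_of_list_snoc:
  assumes "distinct (r # ys)"
  shows "cycle_of_list (ys @ [r]) = cycle_of_list (r # ys)"
  using cycle_of_list_rotate_independent[OF assms, of 1] by simp

lemma cycle_of_list_permutes: "set cs \<subseteq> S \<Longrightarrow> cycle_of_list cs permutes S"
  using cycle_permutes permutes_subset by blast

section \<open>Products of disjoint cycles of odd length\<close>

text \<open>Odd order of \<open>y\<close> is tracked through its cycles, because the extension step
  changes a single cycle in a controlled way, whereas the order of a product of non-commuting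
  factors is hard to control. The superset \<open>T\<close> leaves room for fixed points.\<close>

inductive odd_cycles :: "'a set \<Rightarrow> ('a \<Rightarrow> 'a) \<Rightarrow> bool" where
  id: "odd_cycles S id"
| comp: "\<lbrakk>odd_cycles S p; distinct cs; odd (length cs); set cs \<inter> S = {}; set cs \<union> S \<subseteq> T\<rbrakk>
    \<Longrightarrow> odd_cycles T (cycle_of_list cs \<circ> p)"

lemma odd_cycles_mono:
  assumes "odd_cycles S p" "S \<subseteq> T"
  shows "odd_cycles T p"
  using assms
proof cases
  case (comp S' q cs)
  then show ?thesis using odd_cycles.comp[of S' q cs T] assms(2) by blast
qed (simp add: odd_cycles.id)

lemma odd_cycles_permutes: "odd_cycles S p \<Longrightarrow> p permutes S"
proof (induction rule: odd_cycles.induct)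
  case (id S)
  show "id permutes S" by (rule permutes_id)
next
  case (comp S p cs T)
  then show "cycle_of_list cs \<circ> p permutes T"
    by (intro permutes_compose cycle_of_list_permutes) (auto intro: permutes_subset)
qed

lemma odd_cycles_single:
  assumes "distinct cs" "odd (length cs)" "set cs \<subseteq> S"
  shows "odd_cycles S (cycle_of_list cs)"
  using odd_cycles.comp[OF odd_cycles.id[of "{}"] assms(1,2)] assms(3) by simp

lemma odd_cycles_Un:
  assumes "odd_cycles S p" "odd_cycles T q" "S \<inter> T = {}"
  shows "odd_cycles (S \<union> T) (p \<circ> q)"
  using assms
proof (induction rule: odd_cycles.induct)
  case (id S)
  then show ?case by (simp add: odd_cycles_mono)
next
  case (comp S p cs U)
  have "odd_cycles (S \<union> T) (p \<circ> q)" using comp by blast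
  then have "odd_cycles (U \<union> T) (cycle_of_list cs \<circ> (p \<circ> q))"
    by (rule odd_cycles.comp) (use comp in auto)
  then show "odd_cycles (U \<union> T) ((cycle_of_list cs \<circ> p) \<circ> q)"
    by (simp only: comp_assoc)
qed

text \<open>Disjoint factors commute, so the odd exponent \<open>length cs * k\<close> kills both of
  them.\<close>

lemma odd_cycles_order:
  assumes "odd_cycles S p"
  shows "\<exists>k. odd k \<and> p ^^ k = id"
  using assms
proof (induction rule: odd_cycles.induct)
  case (id S)
  show "\<exists>k. odd k \<and> (id :: 'a \<Rightarrow> 'a) ^^ k = id" by (intro exI[of _ 1]) simp
next
  case (comp S p cs T)
  then obtain k where k: "odd k" "p ^^ k = id" by blast
  have c: "cycle_of_list cs \<circ> p = p \<circ> cycle_of_list cs"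
    using permutes_comp_commute[OF cycle_permutes odd_cycles_permutes] comp by blast
  let ?m = "length cs"
  have "cycle_of_list cs ^^ (?m * k) = id"
    using cycle_is_id_root[OF comp(2)] by (simp add: funpow_mult[symmetric] id_funpow)
  moreover have "p ^^ (?m * k) = id"
    using k by (subst mult.commute) (simp add: funpow_mult[symmetric] id_funpow)
  ultimately have "(cycle_of_list cs \<circ> p) ^^ (?m * k) = id"
    by (simp add: funpow_comp_commute[OF c])
  then show "\<exists>k. odd k \<and> (cycle_of_list cs \<circ> p) ^^ k = id"
    using k comp(3) by (intro exI[of _ "?m * k"]) simp
qed

lemma odd_cycles_evenperm:
  assumes "odd_cycles S p" "finite S"
  shows "evenperm p"
  using assms
proof (induction rule: odd_cycles.induct)
  case (id S)
  show "evenperm (id :: 'a \<Rightarrow> 'a)" by simp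
next
  case (comp S p cs T)
  have "finite S" using comp finite_subset by blast
  then have "permutation p"
    using odd_cycles_permutes[OF comp(1)] permutation_permutes by blast
  moreover have "evenperm (cycle_of_list cs)"
    using evenperm_cycle_of_list[of cs] comp by fastforce
  ultimately show "evenperm (cycle_of_list cs \<circ> p)"
    using evenperm_comp[OF permutation_of_cycle] comp \<open>finite S\<close> by blast
qed

text \<open>Disjoint cycles commute and a cycle may be rotated, so the cycle through
  \<open>p\<close> can be brought to the front with \<open>p\<close> as its head. For a fixed point
  \<open>p\<close> it is the list \<open>[p]\<close>.\<close>

lemma odd_cycles_split:
  assumes "odd_cycles S f" "p \<in> S"
  shows "\<exists>ys w T. distinct (p # ys) \<and> even (length ys) \<and> odd_cycles T w \<and>
    set (p # ys) \<inter> T = {} \<and> set (p # ys) \<union> T \<subseteq> S \<and> f = cycle_of_list (p # ys) \<circ> w"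
  using assms
proof (induction rule: odd_cycles.induct)
  case (id S)
  then have "\<exists>ys w T. distinct (p # ys) \<and> even (length ys) \<and> odd_cycles T w \<and>
    set (p # ys) \<inter> T = {} \<and> set (p # ys) \<union> T \<subseteq> S \<and> id = cycle_of_list (p # ys) \<circ> w"
    by (intro exI[of _ "[]"] exI[of _ id] exI[of _ "S - {p}"]) (auto simp: odd_cycles.id)
  then show ?case .
next
  case (comp S f cs T)
  have "\<exists>ys w U. distinct (p # ys) \<and> even (length ys) \<and> odd_cycles U w \<and>
    set (p # ys) \<inter> U = {} \<and> set (p # ys) \<union> U \<subseteq> T \<and>
    cycle_of_list cs \<circ> f = cycle_of_list (p # ys) \<circ> w"
  proof -
  consider "p \<in> set cs" | "p \<notin> set cs" "p \<in> S" | "p \<notin> set cs" "p \<notin> S" by blast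
  then show ?thesis
  proof cases
    case 1
    then obtain us vs where cs: "cs = us @ p # vs" by (metis split_list)
    have "cycle_of_list cs = cycle_of_list (p # vs @ us)"
      using cycle_of_list_rotate_independent[OF comp(2), of "length us"] unfolding cs
      by (simp add: rotate_append)
    then show ?thesis using comp cs
      by (intro exI[of _ "vs @ us"] exI[of _ f] exI[of _ S]) auto
  next
    case 2
    then obtain ys w U where *: "distinct (p # ys)" "even (length ys)" "odd_cycles U w"
      "set (p # ys) \<inter> U = {}" "set (p # ys) \<union> U \<subseteq> S" "f = cycle_of_list (p # ys) \<circ> w"
      using comp by blast
    have "set cs \<inter> set (p # ys) = {}" using comp(4) *(5) by blast
    then have c: "cycle_of_list cs \<circ> cycle_of_list (p # ys) = cycle_of_list (p # ys) \<circ> cycle_of_list cs"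
      using cycles_commute comp(2) *(1) by blast
    have "odd_cycles (set cs \<union> U) (cycle_of_list cs \<circ> w)"
      using odd_cycles.comp[of U w cs "set cs \<union> U"] * comp by blast
    moreover have "cycle_of_list cs \<circ> f = cycle_of_list (p # ys) \<circ> (cycle_of_list cs \<circ> w)"
      unfolding *(6) o_assoc c ..
    ultimately show ?thesis using * comp(2-5) 2
      by (intro exI[of _ ys] exI[of _ "cycle_of_list cs \<circ> w"] exI[of _ "set cs \<union> U"]) auto
  next
    case 3
    have "odd_cycles (set cs \<union> S) (cycle_of_list cs \<circ> f)"
      using odd_cycles.comp[of S f cs "set cs \<union> S"] comp by blast
    then show ?thesis using comp 3
      by (intro exI[of _ "[]"] exI[of _ "cycle_of_list cs \<circ> f"] exI[of _ "set cs \<union> S"]) auto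
  qed
  qed
  then show ?case .
qed

text \<open>Inserting two new points into the cycle through \<open>p\<close> keeps its length odd.\<close>

lemma odd_cycles_insert:
  assumes f: "odd_cycles S f" and p: "p \<in> S" and qr: "q \<notin> S" "r \<notin> S" "q \<noteq> r"
  shows "odd_cycles (S \<union> {q, r}) (f \<circ> cycle_of_list [p, q, r])"
proof -
  obtain ys w T where *: "distinct (p # ys)" "even (length ys)" "odd_cycles T w"
      "set (p # ys) \<inter> T = {}" "set (p # ys) \<union> T \<subseteq> S" "f = cycle_of_list (p # ys) \<circ> w"
    using odd_cycles_split[OF f p] by metis
  have "set [p, q, r] \<inter> T = {}" using * qr by auto
  then have c: "w \<circ> cycle_of_list [p, q, r] = cycle_of_list [p, q, r] \<circ> w"
    using permutes_comp_commute[OF odd_cycles_permutes[OF *(3)] cycle_permutes] by blast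
  \<comment> \<open>Right multiplication by the 3-cycle places \<open>q\<close> and \<open>r\<close>
    directly after \<open>p\<close>.\<close>
  have "cycle_of_list (p # ys) \<circ> cycle_of_list [p, q, r] = cycle_of_list (p # q # r # ys)"
  proof (cases ys)
    case (Cons y zs)
    have "set (y # zs) \<inter> set [p, q, r] = {}" using * qr Cons by auto
    then have "cycle_of_list (y # zs) \<circ> cycle_of_list [p, q, r] = cycle_of_list [p, q, r] \<circ> cycle_of_list (y # zs)"
      using permutes_comp_commute[OF cycle_permutes cycle_permutes] by blast
    then have "cycle_of_list (p # ys) \<circ> cycle_of_list [p, q, r] =
        transpose p y \<circ> cycle_of_list [p, q, r] \<circ> cycle_of_list (y # zs)"
      by (simp add: Cons comp_assoc)
    \<comment> \<open>Both sides are the 4-cycle \<open>(p q r y)\<close>.\<close>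
    also have "transpose p y \<circ> cycle_of_list [p, q, r] = transpose p q \<circ> transpose q r \<circ> transpose r y"
      using * qr p Cons by (auto simp: fun_eq_iff transpose_def)
    finally show ?thesis by (simp only: Cons cycle_of_list.simps comp_assoc)
  qed simp
  then have "f \<circ> cycle_of_list [p, q, r] = cycle_of_list (p # q # r # ys) \<circ> w"
    unfolding *(6) comp_assoc c by (simp only: comp_assoc[symmetric])
  moreover have "odd_cycles (S \<union> {q, r}) (cycle_of_list (p # q # r # ys) \<circ> w)"
    using * qr p by (intro odd_cycles.comp[OF *(3)]) auto
  ultimately show ?thesis by simp
qed

section \<open>Solutions of the commutator equation and the extension step\<close>

text \<open>\<open>comm_sol S e x y a\<close> encodes a solution of \<open>x = [y, a]\<close> supported on \<open>S\<close>, the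
  equation being written without inverses; \<open>e\<close> records whether \<open>a\<close> is even.\<close>

definition comm_sol ::
  "'a set \<Rightarrow> bool \<Rightarrow> ('a \<Rightarrow> 'a) \<Rightarrow> ('a \<Rightarrow> 'a) \<Rightarrow> ('a \<Rightarrow> 'a) \<Rightarrow> bool" where
  "comm_sol S e x y a \<longleftrightarrow> odd_cycles S y \<and> a permutes S \<and> finite S \<and> a ^^ 4 = id \<and>
     (evenperm a \<longleftrightarrow> e) \<and> a \<circ> y \<circ> x = y \<circ> a"

text \<open>The equation determines \<open>x\<close> as \<open>(a y)^-1 y a\<close>, so
  \<open>x\<close> permutes \<open>S\<close> along with \<open>y\<close> and
  \<open>a\<close>.\<close>

lemma comm_sol_permutes:
  assumes "comm_sol S e x y a"
  shows "y permutes S" "a permutes S" "x permutes S"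
proof -
  show y: "y permutes S" and a: "a permutes S"
    using assms odd_cycles_permutes unfolding comm_sol_def by auto
  have ay: "(a \<circ> y) permutes S" using permutes_compose[OF y a] .
  have "inv' (a \<circ> y) \<circ> (y \<circ> a) = inv' (a \<circ> y) \<circ> (a \<circ> y) \<circ> x"
    using assms unfolding comm_sol_def by (simp only: comp_assoc)
  also have "\<dots> = x" by (simp add: permutes_inv_o(2)[OF ay])
  finally show "x permutes S"
    using permutes_compose[OF permutes_compose[OF a y] permutes_inv[OF ay]] by simp
qed

text \<open>The factors of one solution commute with those of the other, so the equations multiply.
  The product \<open>a b\<close> is even exactly when the two parities agree, hence
  \<open>e = f\<close>.\<close>

lemma comm_sol_Un:
  assumes 1: "comm_sol S e x y a" and 2: "comm_sol T f w z b" and d: "S \<inter> T = {}"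
  shows "comm_sol (S \<union> T) (e = f) (x \<circ> w) (y \<circ> z) (a \<circ> b)"
proof -
  note D = 1[unfolded comm_sol_def] 2[unfolded comm_sol_def]
  note x = comm_sol_permutes(3)[OF 1]
  have y: "y permutes S" and z: "z permutes T" and a: "a permutes S" and b: "b permutes T"
    using comm_sol_permutes[OF 1] comm_sol_permutes[OF 2] by blast+
  note c = permutes_comp_commute[OF _ _ d]
  have "(a \<circ> b) \<circ> (y \<circ> z) \<circ> (x \<circ> w) = (a \<circ> y \<circ> x) \<circ> (b \<circ> z \<circ> w)"
    using c[OF y b] c[OF x z] c[OF x b] by (simp add: fun_eq_iff)
  also have "\<dots> = (y \<circ> a) \<circ> (z \<circ> b)" using D by simp
  also have "\<dots> = (y \<circ> z) \<circ> (a \<circ> b)"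
    using c[OF a z] by (simp add: fun_eq_iff)
  finally have "(a \<circ> b) \<circ> (y \<circ> z) \<circ> (x \<circ> w) = (y \<circ> z) \<circ> (a \<circ> b)" .
  moreover have "(a \<circ> b) ^^ 4 = id"
    using funpow_comp_commute[OF c[OF a b], of 4] D by simp
  moreover have "evenperm (a \<circ> b) \<longleftrightarrow> (e = f)"
    using evenperm_comp[of a b] a b D permutation_permutes by blast
  moreover have "(a \<circ> b) permutes (S \<union> T)"
    using a b by (intro permutes_compose) (auto intro: permutes_subset)
  ultimately show ?thesis
    using D odd_cycles_Un[OF _ _ d, of y z] unfolding comm_sol_def by blast
qed

text \<open>With \<open>t = (p q r)\<close> and \<open>s = (q r)\<close> one has \<open>[y t, a s] = t\<inverse> [y, a] t\<^bsup>as\<^esup>\<close>, because \<open>s\<close>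
  commutes with \<open>y\<close> and \<open>a\<close>.\<close>

lemma comm_sol_extend:
  assumes 1: "comm_sol S e x y a" and P: "P \<in> S" "a P = p" and qr: "q \<notin> S" "r \<notin> S" "q \<noteq> r"
    and x': "cycle_of_list [p, q, r] \<circ> x' = x \<circ> cycle_of_list [P, r, q]"
  shows "comm_sol (S \<union> {q, r}) (\<not> e) x' (y \<circ> cycle_of_list [p, q, r]) (a \<circ> transpose q r)"
proof -
  note D = 1[unfolded comm_sol_def]
  let ?t = "cycle_of_list [p, q, r]" and ?s = "transpose q r"
  note y = comm_sol_permutes(1)[OF 1] and a = comm_sol_permutes(2)[OF 1] and x = comm_sol_permutes(3)[OF 1]
  have p: "p \<in> S" using P permutes_in_image[OF a] by blast
  have s: "?s permutes {q, r}" by (simp add: permutes_swap_id)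
  have d: "S \<inter> {q, r} = {}" using qr by simp
  note c = permutes_comp_commute[OF _ s d]
  \<comment> \<open>Since \<open>a\<close> carries \<open>P\<close> to \<open>p\<close> and fixes
    the new points, conjugation by \<open>a\<close> turns \<open>(P r q)\<close> into
    \<open>(p r q)\<close>, and swapping \<open>q\<close> and \<open>r\<close> turns this into
    \<open>?t\<close>. So \<open>(P r q)\<close> is the conjugate of \<open>t\<close> by
    \<open>as\<close> in the formula above.\<close>
  have "a \<circ> cycle_of_list [P, r, q] \<circ> inv' a = cycle_of_list (map a [P, r, q])"
    using qr P permutes_bij[OF a] by (intro conjugation_of_cycle) auto
  also have "map a [P, r, q] = [p, r, q]"
    using P qr permutes_not_in[OF a] by simp
  finally have "a \<circ> cycle_of_list [P, r, q] \<circ> (inv' a \<circ> a) = cycle_of_list [p, r, q] \<circ> a"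
    by (simp only: comp_assoc[symmetric])
  then have conj: "a \<circ> cycle_of_list [P, r, q] = cycle_of_list [p, r, q] \<circ> a"
    by (simp only: permutes_inv_o(2)[OF a] comp_id)
  have st: "?s \<circ> cycle_of_list [p, r, q] = ?t \<circ> ?s"
  proof -
    have "q \<noteq> p" "r \<noteq> p" using p qr by auto
    then have "transpose q r \<circ> (transpose p r \<circ> transpose r q) = transpose p q"
      using transpose_comp_triple[of q p r] by (simp add: comp_assoc transpose_commute)
    moreover have "?t \<circ> ?s = transpose p q" by (simp add: fun_eq_iff)
    ultimately show ?thesis by (simp add: transpose_commute)
  qed
  have cs: "f \<circ> (?s \<circ> g) = ?s \<circ> (f \<circ> g)" if "f permutes S" for f g
    by (simp only: comp_assoc[symmetric] c[OF that])
  have "(a \<circ> ?s) \<circ> (y \<circ> ?t) \<circ> x' = ?s \<circ> (a \<circ> (y \<circ> (?t \<circ> x')))"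
    by (simp only: comp_assoc cs[OF a])
  also have "\<dots> = ?s \<circ> ((a \<circ> y \<circ> x) \<circ> cycle_of_list [P, r, q])"
    by (simp only: x' comp_assoc)
  also have "\<dots> = ?s \<circ> ((y \<circ> a) \<circ> cycle_of_list [P, r, q])" using D by simp
  also have "\<dots> = ?s \<circ> (y \<circ> (cycle_of_list [p, r, q] \<circ> a))"
    by (simp only: comp_assoc conj)
  also have "\<dots> = y \<circ> ((?s \<circ> cycle_of_list [p, r, q]) \<circ> a)"
    by (simp only: comp_assoc cs[OF y])
  also have "\<dots> = (y \<circ> ?t) \<circ> (a \<circ> ?s)"
    by (simp only: st c[OF a]) (simp only: comp_assoc)
  finally have "(a \<circ> ?s) \<circ> (y \<circ> ?t) \<circ> x' = (y \<circ> ?t) \<circ> (a \<circ> ?s)" .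
  moreover have "odd_cycles (S \<union> {q, r}) (y \<circ> ?t)"
    using D p qr by (intro odd_cycles_insert) auto
  moreover have "(a \<circ> ?s) permutes (S \<union> {q, r})"
    using a s by (intro permutes_compose) (auto intro: permutes_subset)
  moreover have "?s ^^ 4 = id" by (simp add: numeral_eq_Suc)
  then have "(a \<circ> ?s) ^^ 4 = id"
    using funpow_comp_commute[OF c[OF a], of 4] D by simp
  moreover have "evenperm (a \<circ> ?s) \<longleftrightarrow> \<not> e"
    using evenperm_comp[of a ?s] evenperm_swap[of q r] permutation_swap_id[of q r] D a qr
      permutation_permutes by auto
  ultimately show ?thesis using D unfolding comm_sol_def by blast
qed


section \<open>Lengthening a cycle by two points\<close>

text \<open>This is the condition on \<open>x'\<close> in \<open>comm_sol_extend\<close> for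
  \<open>P = p\<close>, with the new points on either side of \<open>p\<close>. Rotating
  \<open>r\<close> to the front and writing \<open>(q ys)\<close> as a conjugate of
  \<open>(p ys)\<close> leaves transpositions of \<open>p\<close>, \<open>q\<close>,
  \<open>r\<close>, and \<open>(q r)\<close> commutes with \<open>(p ys)\<close>.\<close>

lemma cycle_of_list_sandwich:
  assumes "distinct (p # ys)" "q \<notin> set (p # ys)" "r \<notin> set (p # ys)" "q \<noteq> r"
  shows "cycle_of_list [p, q, r] \<circ> cycle_of_list (p # q # ys @ [r]) =
    cycle_of_list (p # ys) \<circ> cycle_of_list [p, r, q]"
proof -
  have "distinct (r # p # q # ys)" using assms by auto
  then have "cycle_of_list (p # q # ys @ [r]) = transpose r p \<circ> transpose p q \<circ> cycle_of_list (q # ys)"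
    using cycle_of_list_snoc[of r "p # q # ys"] by (simp add: comp_assoc)
  moreover have "transpose p q \<circ> cycle_of_list (p # ys) \<circ> inv' (transpose p q) = cycle_of_list (map (transpose p q) (p # ys))"
    using assms by (intro conjugation_of_cycle) auto
  moreover have "map (transpose p q) ys = ys"
    using assms by (intro map_idI) (auto simp: transpose_def)
  ultimately have "cycle_of_list (p # q # ys @ [r]) =
      transpose r p \<circ> (transpose p q \<circ> (transpose p q \<circ> cycle_of_list (p # ys) \<circ> transpose p q))"
    by (simp add: comp_assoc)
  also have "\<dots> = transpose r p \<circ> cycle_of_list (p # ys) \<circ> transpose p q"
    by (simp add: fun_eq_iff)
  finally have "cycle_of_list [p, q, r] \<circ> cycle_of_list (p # q # ys @ [r]) =
      (transpose p q \<circ> transpose q r \<circ> transpose r p) \<circ> cycle_of_list (p # ys) \<circ> transpose p q"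
    by (simp only: cycle_of_list.simps comp_assoc id_comp)
  also have "transpose p q \<circ> transpose q r \<circ> transpose r p = transpose q r"
    using assms by (auto simp: fun_eq_iff transpose_def)
  also have "transpose q r \<circ> cycle_of_list (p # ys) = cycle_of_list (p # ys) \<circ> transpose q r"
    using assms by (intro permutes_comp_commute[of _ "{q, r}" _ "set (p # ys)"] cycle_permutes)
      (auto simp: permutes_swap_id)
  also have "\<dots> \<circ> transpose p q = cycle_of_list (p # ys) \<circ> (transpose q r \<circ> transpose p q)"
    by (simp only: comp_assoc)
  also have "transpose q r \<circ> transpose p q = cycle_of_list [p, r, q]"
    using assms by (auto simp: fun_eq_iff transpose_def)
  finally show ?thesis .
qed

text \<open>This is the condition on \<open>x'\<close> in \<open>comm_sol_extend\<close> for an edge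
  from \<open>P\<close> to \<open>p\<close>, with the new points inserted into the edge. Splitting
  off \<open>(p ys)\<close> leaves an identity on the four points \<open>P\<close>,
  \<open>p\<close>, \<open>q\<close>, \<open>r\<close>.\<close>

lemma cycle_of_list_insert_between:
  assumes "distinct (P # p # ys)" "q \<notin> set (P # p # ys)" "r \<notin> set (P # p # ys)" "q \<noteq> r"
  shows "cycle_of_list [p, q, r] \<circ> cycle_of_list (P # q # r # p # ys) =
    cycle_of_list (P # p # ys) \<circ> cycle_of_list [P, r, q]"
proof -
  have "cycle_of_list [p, q, r] \<circ> cycle_of_list (P # q # r # p # ys) =
      (transpose p q \<circ> transpose q r \<circ> transpose P q \<circ> transpose q r \<circ> transpose r p) \<circ> cycle_of_list (p # ys)"
    by (simp only: cycle_of_list.simps comp_assoc id_comp)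
  also have "transpose p q \<circ> transpose q r \<circ> transpose P q \<circ> transpose q r \<circ> transpose r p =
      transpose P p \<circ> cycle_of_list [P, r, q]"
    using assms by (auto simp: fun_eq_iff transpose_def)
  also have "\<dots> \<circ> cycle_of_list (p # ys) = transpose P p \<circ> (cycle_of_list [P, r, q] \<circ> cycle_of_list (p # ys))"
    by (simp only: comp_assoc)
  also have "cycle_of_list [P, r, q] \<circ> cycle_of_list (p # ys) = cycle_of_list (p # ys) \<circ> cycle_of_list [P, r, q]"
    using assms by (intro cycles_commute) auto
  finally show ?thesis by (simp only: cycle_of_list.simps comp_assoc)
qed

text \<open>The iterable forms of the extension step: a cycle is lengthened by two points next to a point
  fixed by \<open>a\<close>, or between two consecutive points of which \<open>a\<close> maps the first to the second.\<close>

definition fixed_point_sol :: "'a set \<Rightarrow> ('a \<Rightarrow> 'a) \<Rightarrow> nat \<Rightarrow> bool \<Rightarrow> bool" where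
  "fixed_point_sol W w m e \<longleftrightarrow> (\<forall>p ys. length ys = m \<longrightarrow> distinct (p # ys) \<longrightarrow> set (p # ys) \<inter> W = {} \<longrightarrow>
     (\<exists>y a. comm_sol (set (p # ys) \<union> W) e (cycle_of_list (p # ys) \<circ> w) y a \<and> a p = p))"

definition edge_sol :: "'a \<Rightarrow> 'a set \<Rightarrow> ('a \<Rightarrow> 'a) \<Rightarrow> nat \<Rightarrow> bool \<Rightarrow> bool" where
  "edge_sol s W w m e \<longleftrightarrow> (\<forall>P p ys. length ys = m \<longrightarrow> distinct (P # p # ys) \<longrightarrow> set (P # p # ys) \<inter> W = {} \<longrightarrow>
     (\<exists>y a. comm_sol (set (P # p # ys) \<union> W) e (cycle_of_list (P # p # ys) \<circ> w) y a \<and> a P = p \<and> a s = s))"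

lemma fixed_point_solD:
  assumes "fixed_point_sol W w m e" "length ys = m" "distinct (p # ys)" "set (p # ys) \<inter> W = {}"
  obtains y a where "comm_sol (set (p # ys) \<union> W) e (cycle_of_list (p # ys) \<circ> w) y a" "a p = p"
  using assms unfolding fixed_point_sol_def by metis

lemma edge_solD:
  assumes "edge_sol s W w m e" "length ys = m" "distinct (P # p # ys)" "set (P # p # ys) \<inter> W = {}"
  obtains y a where "comm_sol (set (P # p # ys) \<union> W) e (cycle_of_list (P # p # ys) \<circ> w) y a"
    "a P = p" "a s = s"
  using assms unfolding edge_sol_def by metis

text \<open>The new factor \<open>(q r)\<close> of \<open>a\<close> does not move \<open>p\<close>,
  so \<open>p\<close> remains fixed and the step can be repeated.\<close>

lemma fixed_point_sol_step:
  assumes "fixed_point_sol W w m e" and w: "w permutes W"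
  shows "fixed_point_sol W w (m + 2) (\<not> e)"
  unfolding fixed_point_sol_def
proof (intro allI impI)
  fix p and zs :: "'a list"
  assume l: "length zs = m + 2" and dz: "distinct (p # zs)" and W: "set (p # zs) \<inter> W = {}"
  \<comment> \<open>The new points are the first and the last entry of \<open>zs\<close>, the two
    neighbours of \<open>p\<close> in the cycle.\<close>
  obtain q us where "zs = q # us" using l by (cases zs) auto
  moreover obtain ys r where "us = ys @ [r]" using l calculation by (cases us rule: rev_cases) auto
  ultimately have zs: "zs = q # ys @ [r]" by simp
  obtain y a where ya: "comm_sol (set (p # ys) \<union> W) e (cycle_of_list (p # ys) \<circ> w) y a" "a p = p"
    by (rule fixed_point_solD[OF assms(1), of ys p]) (use l dz W zs in auto)
  have "set [p, r, q] \<inter> W = {}" using W zs by auto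
  then have c: "w \<circ> cycle_of_list [p, r, q] = cycle_of_list [p, r, q] \<circ> w"
    using permutes_comp_commute[OF w cycle_permutes] by blast
  have eq: "cycle_of_list [p, q, r] \<circ> cycle_of_list (p # zs) = cycle_of_list (p # ys) \<circ> cycle_of_list [p, r, q]"
    unfolding zs by (rule cycle_of_list_sandwich) (use dz zs in auto)
  have "cycle_of_list [p, q, r] \<circ> (cycle_of_list (p # zs) \<circ> w) = (cycle_of_list (p # ys) \<circ> w) \<circ> cycle_of_list [p, r, q]"
    unfolding comp_assoc c unfolding comp_assoc[symmetric] eq ..
  from comm_sol_extend[OF ya(1) _ ya(2) _ _ _ this] have
    "comm_sol (set (p # ys) \<union> W \<union> {q, r}) (\<not> e) (cycle_of_list (p # zs) \<circ> w)
      (y \<circ> cycle_of_list [p, q, r]) (a \<circ> transpose q r)"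
    using dz W zs by auto
  moreover have "set (p # ys) \<union> W \<union> {q, r} = set (p # zs) \<union> W" using zs by auto
  moreover have "(a \<circ> transpose q r) p = p" using ya(2) dz zs by auto
  ultimately show "\<exists>y a. comm_sol (set (p # zs) \<union> W) (\<not> e) (cycle_of_list (p # zs) \<circ> w) y a \<and> a p = p"
    by metis
qed

text \<open>The new \<open>a\<close> sends \<open>q\<close> to \<open>r\<close>, so the inserted
  pair is itself an edge for the next step. The fixed point \<open>s\<close> in \<open>W\<close> is
  carried along so that a second cycle can be lengthened afterwards.\<close>

lemma edge_sol_step:
  assumes "edge_sol s W w m e" and w: "w permutes W" and s: "s \<in> W"
  shows "edge_sol s W w (m + 2) (\<not> e)"
  unfolding edge_sol_def
proof (intro allI impI)
  fix q r and zs :: "'a list"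
  assume l: "length zs = m + 2" and dz: "distinct (q # r # zs)" and W: "set (q # r # zs) \<inter> W = {}"
  obtain p us where "zs = p # us" using l by (cases zs) auto
  moreover obtain ys P where "us = ys @ [P]" using l calculation by (cases us rule: rev_cases) auto
  ultimately have zs: "zs = p # ys @ [P]" by simp
  \<comment> \<open>The new edge has to head the list; the rotation exposes the old edge from
    \<open>P\<close> to \<open>p\<close>, with \<open>q\<close> and \<open>r\<close> inside
    it.\<close>
  have rot: "cycle_of_list (q # r # zs) = cycle_of_list (P # q # r # p # ys)"
    using cycle_of_list_snoc[of P "q # r # p # ys"] dz zs by auto
  obtain y a where ya: "comm_sol (set (P # p # ys) \<union> W) e (cycle_of_list (P # p # ys) \<circ> w) y a" "a P = p" "a s = s"
    by (rule edge_solD[OF assms(1), of ys P p]) (use l dz W zs in auto)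
  have "set [P, r, q] \<inter> W = {}" using W zs by auto
  then have c: "w \<circ> cycle_of_list [P, r, q] = cycle_of_list [P, r, q] \<circ> w"
    using permutes_comp_commute[OF w cycle_permutes] by blast
  have eq: "cycle_of_list [p, q, r] \<circ> cycle_of_list (q # r # zs) = cycle_of_list (P # p # ys) \<circ> cycle_of_list [P, r, q]"
    unfolding rot by (rule cycle_of_list_insert_between) (use dz zs in auto)
  have "cycle_of_list [p, q, r] \<circ> (cycle_of_list (q # r # zs) \<circ> w) = (cycle_of_list (P # p # ys) \<circ> w) \<circ> cycle_of_list [P, r, q]"
    unfolding comp_assoc c unfolding comp_assoc[symmetric] eq ..
  from comm_sol_extend[OF ya(1) _ ya(2) _ _ _ this] have
    "comm_sol (set (P # p # ys) \<union> W \<union> {q, r}) (\<not> e) (cycle_of_list (q # r # zs) \<circ> w)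
      (y \<circ> cycle_of_list [p, q, r]) (a \<circ> transpose q r)"
    using dz W zs by auto
  moreover have "set (P # p # ys) \<union> W \<union> {q, r} = set (q # r # zs) \<union> W" using zs by auto
  moreover have "s \<noteq> q" "s \<noteq> r" using s W by auto
  then have "(a \<circ> transpose q r) s = s" using ya(3) by simp
  moreover have "a permutes (set (P # p # ys) \<union> W)" using comm_sol_permutes(2)[OF ya(1)] .
  then have "(a \<circ> transpose q r) q = r"
    using permutes_not_in[of a _ r] W dz zs by auto
  ultimately show "\<exists>y a. comm_sol (set (q # r # zs) \<union> W) (\<not> e) (cycle_of_list (q # r # zs) \<circ> w) y a \<and> a q = r \<and> a s = s"
    by metis
qed

lemma fixed_point_sol_iterate:
  assumes "fixed_point_sol W w m e" and "w permutes W"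
  shows "fixed_point_sol W w (m + 2 * k) (e \<longleftrightarrow> even k)"
proof (induction k)
  case (Suc k)
  then show ?case using fixed_point_sol_step[OF Suc assms(2)] by (simp add: algebra_simps)
qed (use assms in simp)

lemma edge_sol_iterate:
  assumes "edge_sol s W w m e" and "w permutes W" "s \<in> W"
  shows "edge_sol s W w (m + 2 * k) (e \<longleftrightarrow> even k)"
proof (induction k)
  case (Suc k)
  then show ?case using edge_sol_step[OF Suc assms(2,3)] by (simp add: algebra_simps)
qed (use assms in simp)


section \<open>Small explicit solutions\<close>

text \<open>Outside \<open>S\<close> all three maps are the identity, so both equations are checked
  at the points of \<open>S\<close> only. For an explicit solution this is a finite
  evaluation.\<close>

lemma comm_solI:
  assumes "odd_cycles S y" "a permutes S" "finite S" "evenperm a \<longleftrightarrow> e" "x permutes S"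
    "\<forall>z\<in>S. a (a (a (a z))) = z" "\<forall>z\<in>S. a (y (x z)) = y (a z)"
  shows "comm_sol S e x y a"
proof -
  have y: "y permutes S" using assms(1) by (rule odd_cycles_permutes)
  have "a ^^ 4 = id"
  proof
    fix z
    show "(a ^^ 4) z = id z"
      using assms(6) permutes_not_in[OF assms(2), of z]
      by (cases "z \<in> S") (simp_all add: numeral_eq_Suc)
  qed
  moreover have "a \<circ> y \<circ> x = y \<circ> a"
  proof
    fix z
    show "(a \<circ> y \<circ> x) z = (y \<circ> a) z"
      using assms(7) permutes_not_in[OF assms(2), of z] permutes_not_in[OF y, of z]
        permutes_not_in[OF assms(5), of z]
      by (cases "z \<in> S") simp_all
  qed
  ultimately show ?thesis using assms unfolding comm_sol_def by blast
qed

lemma comm_sol_id: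
  assumes "finite S"
  shows "comm_sol S True id id id"
  using assms by (intro comm_solI odd_cycles.id permutes_id) auto

text \<open>Every \<open>a\<close> commutes with \<open>y = id\<close>, so two fixed points of
  \<open>x\<close> make room for an odd \<open>a\<close>.\<close>

lemma comm_sol_id_odd:
  assumes "finite S" "b \<in> S" "c \<in> S" "b \<noteq> c"
  shows "comm_sol S False id id (transpose b c)"
  using assms by (intro comm_solI odd_cycles.id permutes_id permutes_swap_id) (auto simp: evenperm_swap)

text \<open>The following small solutions were found by a computer search.\<close>

lemma comm_sol_5:
  assumes "distinct [b, c, d, e, f]"
  shows "comm_sol {b, c, d, e, f} False
    (cycle_of_list [b, c, d, e, f]) (cycle_of_list [b, f, e]) (cycle_of_list [c, f, d, e])"
proof -
  \<comment> \<open>The reversed list supplies each inequality in the opposite orientation for the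
    simplifier.\<close>
  have d: "distinct [f, e, d, c, b]" using assms by auto
  show ?thesis
  proof (intro comm_solI)
    show "odd_cycles {b, c, d, e, f} (cycle_of_list [b, f, e])"
      using assms by (intro odd_cycles_single) auto
    show "(cycle_of_list [c, f, d, e]) permutes {b, c, d, e, f}"
      by (intro permutes_compose cycle_of_list_permutes) auto
    show "evenperm (cycle_of_list [c, f, d, e]) \<longleftrightarrow> False"
      using assms d by (simp add: evenperm_cycle_of_list del: cycle_of_list.simps)
    show "(cycle_of_list [b, c, d, e, f]) permutes {b, c, d, e, f}"
      by (intro permutes_compose cycle_of_list_permutes) auto
  qed (use assms d in simp_all)
qed

lemma comm_sol_2_2:
  assumes "distinct [b, c, d, e]"
  shows "comm_sol {b, c, d, e} True
    (cycle_of_list [b, c] \<circ> cycle_of_list [d, e]) (cycle_of_list [c, e, d]) (cycle_of_list [b, d] \<circ> cycle_of_list [c, e])"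
proof -
  have d: "distinct [e, d, c, b]" using assms by auto
  show ?thesis
  proof (intro comm_solI)
    show "odd_cycles {b, c, d, e} (cycle_of_list [c, e, d])"
      using assms by (intro odd_cycles_single) auto
    show "(cycle_of_list [b, d] \<circ> cycle_of_list [c, e]) permutes {b, c, d, e}"
      by (intro permutes_compose cycle_of_list_permutes) auto
    show "evenperm (cycle_of_list [b, d] \<circ> cycle_of_list [c, e]) \<longleftrightarrow> True"
      using assms d by (simp add: evenperm_comp permutation_of_cycle evenperm_cycle_of_list del: cycle_of_list.simps)
    show "(cycle_of_list [b, c] \<circ> cycle_of_list [d, e]) permutes {b, c, d, e}"
      by (intro permutes_compose cycle_of_list_permutes) auto
  qed (use assms d in simp_all)
qed

lemma comm_sol_1_2_2:
  assumes "distinct [f, b, c, d, e]"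
  shows "comm_sol {f, b, c, d, e} False
    (cycle_of_list [f] \<circ> cycle_of_list [b, c] \<circ> cycle_of_list [d, e]) (cycle_of_list [b, d, c, e, f]) (cycle_of_list [d, e])"
proof -
  have d: "distinct [e, d, c, b, f]" using assms by auto
  show ?thesis
  proof (intro comm_solI)
    show "odd_cycles {f, b, c, d, e} (cycle_of_list [b, d, c, e, f])"
      using assms by (intro odd_cycles_single) auto
    show "(cycle_of_list [d, e]) permutes {f, b, c, d, e}"
      by (intro permutes_compose cycle_of_list_permutes) auto
    show "evenperm (cycle_of_list [d, e]) \<longleftrightarrow> False"
      using assms d by (simp add: evenperm_cycle_of_list del: cycle_of_list.simps)
    show "(cycle_of_list [f] \<circ> cycle_of_list [b, c] \<circ> cycle_of_list [d, e]) permutes {f, b, c, d, e}"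
      by (intro permutes_compose cycle_of_list_permutes) auto
  qed (use assms d in simp_all)
qed

lemma comm_sol_3_3:
  assumes "distinct [b, c, d, e, f, g]"
  shows "comm_sol {b, c, d, e, f, g} False
    (cycle_of_list [b, c, d] \<circ> cycle_of_list [e, f, g]) (cycle_of_list [b, d, f, c, g]) (cycle_of_list [d, e, f, g])"
proof -
  have d: "distinct [g, f, e, d, c, b]" using assms by auto
  show ?thesis
  proof (intro comm_solI)
    show "odd_cycles {b, c, d, e, f, g} (cycle_of_list [b, d, f, c, g])"
      using assms by (intro odd_cycles_single) auto
    show "(cycle_of_list [d, e, f, g]) permutes {b, c, d, e, f, g}"
      by (intro permutes_compose cycle_of_list_permutes) auto
    show "evenperm (cycle_of_list [d, e, f, g]) \<longleftrightarrow> False"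
      using assms d by (simp add: evenperm_cycle_of_list del: cycle_of_list.simps)
    show "(cycle_of_list [b, c, d] \<circ> cycle_of_list [e, f, g]) permutes {b, c, d, e, f, g}"
      by (intro permutes_compose cycle_of_list_permutes) auto
  qed (use assms d in simp_all)
qed

lemma comm_sol_4_2_odd:
  assumes "distinct [d, e, f, g, b, c]"
  shows "comm_sol {d, e, f, g, b, c} False
    (cycle_of_list [d, e, f, g] \<circ> cycle_of_list [b, c]) (cycle_of_list [b, c, f, g, e]) (cycle_of_list [c, d, e, f])"
proof -
  have d: "distinct [c, b, g, f, e, d]" using assms by auto
  show ?thesis
  proof (intro comm_solI)
    show "odd_cycles {d, e, f, g, b, c} (cycle_of_list [b, c, f, g, e])"
      using assms by (intro odd_cycles_single) auto
    show "(cycle_of_list [c, d, e, f]) permutes {d, e, f, g, b, c}"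
      by (intro permutes_compose cycle_of_list_permutes) auto
    show "evenperm (cycle_of_list [c, d, e, f]) \<longleftrightarrow> False"
      using assms d by (simp add: evenperm_cycle_of_list del: cycle_of_list.simps)
    show "(cycle_of_list [d, e, f, g] \<circ> cycle_of_list [b, c]) permutes {d, e, f, g, b, c}"
      by (intro permutes_compose cycle_of_list_permutes) auto
  qed (use assms d in simp_all)
qed

lemma comm_sol_4_2_even:
  assumes "distinct [d, e, f, g, b, c]"
  shows "comm_sol {d, e, f, g, b, c} True
    (cycle_of_list [d, e, f, g] \<circ> cycle_of_list [b, c]) (cycle_of_list [b, d, g, c, e]) (cycle_of_list [d, e] \<circ> cycle_of_list [f, g])"
proof -
  have d: "distinct [c, b, g, f, e, d]" using assms by auto
  show ?thesis
  proof (intro comm_solI)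
    show "odd_cycles {d, e, f, g, b, c} (cycle_of_list [b, d, g, c, e])"
      using assms by (intro odd_cycles_single) auto
    show "(cycle_of_list [d, e] \<circ> cycle_of_list [f, g]) permutes {d, e, f, g, b, c}"
      by (intro permutes_compose cycle_of_list_permutes) auto
    show "evenperm (cycle_of_list [d, e] \<circ> cycle_of_list [f, g]) \<longleftrightarrow> True"
      using assms d by (simp add: evenperm_comp permutation_of_cycle evenperm_cycle_of_list del: cycle_of_list.simps)
    show "(cycle_of_list [d, e, f, g] \<circ> cycle_of_list [b, c]) permutes {d, e, f, g, b, c}"
      by (intro permutes_compose cycle_of_list_permutes) auto
  qed (use assms d in simp_all)
qed


section \<open>Starting points of the extension process\<close>

lemma fixed_point_sol_1: "fixed_point_sol {} id 0 True"
  using comm_sol_id unfolding fixed_point_sol_def by (metis List.finite_set Un_empty_right comp_id cycle_of_list.simps(3) id_apply length_0_conv)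

text \<open>Two extension steps lead from a single point to length 5 with even \<open>a\<close>.
  This second start has odd \<open>a\<close> at length 5, so both parities are available from there
  on.\<close>

lemma fixed_point_sol_5: "fixed_point_sol {} id 4 False"
  unfolding fixed_point_sol_def
proof (intro allI impI)
  fix p :: 'a and ys
  assume *: "length ys = 4" "distinct (p # ys)"
  then obtain c d e f where ys: "ys = [c, d, e, f]"
    by (auto simp: numeral_eq_Suc length_Suc_conv)
  have "cycle_of_list [c, f, d, e] p = p" using * ys by (intro id_outside_supp) auto
  then show "\<exists>y a. comm_sol (set (p # ys) \<union> {}) False (cycle_of_list (p # ys) \<circ> id) y a \<and> a p = p"
    using comm_sol_5[of p c d e f] * unfolding ys by (auto simp del: cycle_of_list.simps)
qed

text \<open>One extension step turns the fixed point into a 3-cycle and makes \<open>a\<close> even,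
  the parity that the product of \<open>comm_rep_3_cycle\<close> and \<open>comm_rep_2_2\<close>
  does not give.\<close>

lemma fixed_point_sol_1_2_2:
  assumes "distinct [b, c, d, e]"
  shows "fixed_point_sol {b, c, d, e} (cycle_of_list [b, c] \<circ> cycle_of_list [d, e]) 0 False"
  unfolding fixed_point_sol_def
proof (intro allI impI)
  fix p and ys :: "'a list"
  assume *: "length ys = 0" "set (p # ys) \<inter> {b, c, d, e} = {}"
  then have "cycle_of_list [d, e] p = p" by (intro id_outside_supp) auto
  moreover have "distinct [p, b, c, d, e]" using * assms by auto
  note comm_sol_1_2_2[OF this]
  moreover have "set (p # ys) \<union> {b, c, d, e} = {p, b, c, d, e}"
    "cycle_of_list (p # ys) = cycle_of_list [p]" using * by auto
  ultimately show "\<exists>y a. comm_sol (set (p # ys) \<union> {b, c, d, e}) False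
      (cycle_of_list (p # ys) \<circ> (cycle_of_list [b, c] \<circ> cycle_of_list [d, e])) y a \<and> a p = p"
    by (metis comp_assoc)
qed

text \<open>Both parities are present at the start, hence at all later lengths. The point
  \<open>b\<close> of the 2-cycle is fixed by \<open>a\<close>; the 2-cycle will be lengthened
  there.\<close>

lemma edge_sol_4_2:
  assumes "b \<noteq> c"
  shows "edge_sol b {b, c} (cycle_of_list [b, c]) 2 e"
  unfolding edge_sol_def
proof (intro allI impI)
  fix P p and ys :: "'a list"
  assume *: "length ys = 2" "distinct (P # p # ys)" "set (P # p # ys) \<inter> {b, c} = {}"
  then obtain f g where ys: "ys = [f, g]" by (auto simp: numeral_eq_Suc length_Suc_conv)
  have S: "set (P # p # ys) \<union> {b, c} = {P, p, f, g, b, c}" using ys by auto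
  have d: "distinct [P, p, f, g, b, c]" and d': "distinct [c, b, g, f, p, P]"
    using * ys assms by auto
  show "\<exists>y a. comm_sol (set (P # p # ys) \<union> {b, c}) e
      (cycle_of_list (P # p # ys) \<circ> cycle_of_list [b, c]) y a \<and> a P = p \<and> a b = b"
  proof (cases e)
    case True
    then have e: "e = True" by simp
    have "(cycle_of_list [P, p] \<circ> cycle_of_list [f, g]) P = p"
      "(cycle_of_list [P, p] \<circ> cycle_of_list [f, g]) b = b"
      using d d' by simp_all
    with comm_sol_4_2_even[OF d] show ?thesis
      unfolding S e unfolding ys by - (intro exI conjI)
  next
    case False
    then have e: "e = False" by simp
    have "cycle_of_list [c, P, p, f] P = p" "cycle_of_list [c, P, p, f] b = b"
      using d d' by simp_all
    with comm_sol_4_2_odd[OF d] show ?thesis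
      unfolding S e unfolding ys by - (intro exI conjI)
  qed
qed

section \<open>Cycles and pairs of cycles with prescribed parity\<close>

definition comm_rep :: "'a set \<Rightarrow> bool \<Rightarrow> ('a \<Rightarrow> 'a) \<Rightarrow> bool" where
  "comm_rep S e x \<longleftrightarrow> (\<exists>y a. comm_sol S e x y a)"

lemma comm_repI: "comm_sol S e x y a \<Longrightarrow> comm_rep S e x"
  unfolding comm_rep_def by blast

lemma comm_rep_id: "finite S \<Longrightarrow> comm_rep S True id"
  using comm_sol_id unfolding comm_rep_def by blast

lemma comm_rep_Un:
  assumes "comm_rep S e x" "comm_rep T f w" "S \<inter> T = {}"
  shows "comm_rep (S \<union> T) (e = f) (x \<circ> w)"
  using assms comm_sol_Un unfolding comm_rep_def by metis

text \<open>The flexible part is taken with parity \<open>e = f\<close>, which combines with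
  \<open>f\<close> to give \<open>e\<close>.\<close>

lemma comm_rep_Un_left:
  assumes "\<And>e. comm_rep S e x" "comm_rep T f w" "S \<inter> T = {}"
  shows "comm_rep (S \<union> T) e (x \<circ> w)"
  using comm_rep_Un[OF assms(1)[of "e = f"] assms(2,3)] by (cases e; cases f) auto

lemma comm_rep_Un_right:
  assumes "comm_rep S f x" "\<And>e. comm_rep T e w" "S \<inter> T = {}"
  shows "comm_rep (S \<union> T) e (x \<circ> w)"
  using comm_rep_Un[OF assms(1) assms(2)[of "e = f"] assms(3)] by (cases e; cases f) auto

lemma fixed_point_sol_rep:
  assumes "fixed_point_sol W w m e" "length cs = Suc m" "distinct cs" "set cs \<inter> W = {}"
  shows "comm_rep (set cs \<union> W) e (cycle_of_list cs \<circ> w)"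
proof (cases cs)
  case (Cons p ys)
  obtain y a where "comm_sol (set (p # ys) \<union> W) e (cycle_of_list (p # ys) \<circ> w) y a"
    by (rule fixed_point_solD[OF assms(1), of ys p]) (use assms Cons in auto)
  then show ?thesis using Cons unfolding comm_rep_def by blast
qed (use assms in simp)

lemma comm_rep_3_cycle:
  assumes "distinct cs" "length cs = 3"
  shows "comm_rep (set cs) False (cycle_of_list cs)"
  using fixed_point_sol_rep[OF fixed_point_sol_iterate[OF fixed_point_sol_1 permutes_id, of 1], of cs]
    assms by simp

lemma comm_rep_long_odd_cycle:
  assumes "distinct cs" "odd (length cs)" "length cs \<ge> 5"
  shows "comm_rep (set cs) e (cycle_of_list cs)"
proof -
  \<comment> \<open>\<open>k\<close> counts the steps from length 5; from a single point it takes
    two more. The two starts have opposite parities and \<open>k\<close>, \<open>k + 2\<close> are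
    congruent mod 2, so one of them ends with parity \<open>e\<close>.\<close>
  define k where "k = (length cs - 5) div 2"
  have l: "length cs = Suc (4 + 2 * k)" "length cs = Suc (0 + 2 * (k + 2))"
    using assms unfolding k_def by presburger+
  show ?thesis
    using fixed_point_sol_rep[OF fixed_point_sol_iterate[OF fixed_point_sol_5 permutes_id] l(1) assms(1)]
      fixed_point_sol_rep[OF fixed_point_sol_iterate[OF fixed_point_sol_1 permutes_id] l(2) assms(1)]
    by (cases e; cases "even k") auto
qed

text \<open>The cycles are lengthened one after the other: first \<open>cs\<close> from a 4-cycle
  along edges, next to a 2-cycle that stays as it is; then \<open>ds\<close> from this 2-cycle at
  its point fixed by \<open>a\<close>, next to the finished \<open>cs\<close>.\<close>

lemma comm_rep_long_even_pair:
  assumes "distinct cs" "even (length cs)" "length cs \<ge> 4"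
    and "distinct ds" "even (length ds)" "length ds \<ge> 2" and d: "set cs \<inter> set ds = {}"
  shows "comm_rep (set cs \<union> set ds) e (cycle_of_list cs \<circ> cycle_of_list ds)"
proof -
  have *: "fixed_point_sol (set cs) (cycle_of_list cs) 1 e" for e
    unfolding fixed_point_sol_def
  proof (intro allI impI)
    fix p and zs :: "'a list"
    assume "length zs = 1" and dz: "distinct (p # zs)" "set (p # zs) \<inter> set cs = {}"
    then obtain v where zs: "zs = [v]" by (auto simp: length_Suc_conv)
    obtain q r ys where cs: "cs = q # r # ys" using assms(3) by (cases cs; cases "tl cs") auto
    define k where "k = (length ys - 2) div 2"
    have l: "length ys = 2 + 2 * k" using assms(2,3) unfolding k_def cs by simp
    have "p \<noteq> v" using dz zs by simp
    \<comment> \<open>The start is taken with the parity that \<open>k\<close> changes turn into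
      \<open>e\<close>.\<close>
    have parity: "((e = even k) = even k) = e" by auto
    have "cycle_of_list [p, v] permutes {p, v}" by (rule cycle_of_list_permutes) simp
    from edge_sol_iterate[OF edge_sol_4_2[where e = "e = even k", OF \<open>p \<noteq> v\<close>] this, where k = k]
    have es: "edge_sol p {p, v} (cycle_of_list [p, v]) (2 + 2 * k) e"
      unfolding parity by blast
    obtain y a where "comm_sol (set cs \<union> {p, v}) e (cycle_of_list cs \<circ> cycle_of_list [p, v]) y a" "a p = p"
      unfolding cs by (rule edge_solD[OF es l, of q r]) (use assms(1) dz zs cs in auto)
    moreover have "cycle_of_list cs \<circ> cycle_of_list [p, v] = cycle_of_list [p, v] \<circ> cycle_of_list cs"
      using assms(1) dz zs by (intro cycles_commute) auto
    moreover have "set cs \<union> {p, v} = set (p # zs) \<union> set cs" using zs by auto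
    ultimately show "\<exists>y a. comm_sol (set (p # zs) \<union> set cs) e (cycle_of_list (p # zs) \<circ> cycle_of_list cs) y a \<and> a p = p"
      unfolding zs by metis
  qed
  define j where "j = (length ds - 2) div 2"
  have l: "length ds = Suc (1 + 2 * j)" using assms(5,6) unfolding j_def by presburger
  have parity: "((e = even j) = even j) = e" by auto
  have "set ds \<inter> set cs = {}" using d by auto
  from fixed_point_sol_rep[OF fixed_point_sol_iterate[OF *[of "e = even j"] cycle_permutes] l assms(4) this]
  have "comm_rep (set ds \<union> set cs) e (cycle_of_list ds \<circ> cycle_of_list cs)"
    unfolding parity .
  moreover have "cycle_of_list ds \<circ> cycle_of_list cs = cycle_of_list cs \<circ> cycle_of_list ds"
    using d assms by (intro cycles_commute) auto
  ultimately show ?thesis by (simp add: Un_commute)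
qed

lemma comm_rep_even_pair:
  assumes "distinct cs" "even (length cs)" "length cs \<ge> 2"
    and "distinct ds" "even (length ds)" "length ds \<ge> 2" and d: "set cs \<inter> set ds = {}"
    and "length cs \<noteq> 2 \<or> length ds \<noteq> 2"
  shows "comm_rep (set cs \<union> set ds) e (cycle_of_list cs \<circ> cycle_of_list ds)"
proof (cases "length cs = 2")
  case True
  then have "length ds \<ge> 4" using assms by presburger
  then have "comm_rep (set ds \<union> set cs) e (cycle_of_list ds \<circ> cycle_of_list cs)"
    using assms by (intro comm_rep_long_even_pair) auto
  moreover have "cycle_of_list ds \<circ> cycle_of_list cs = cycle_of_list cs \<circ> cycle_of_list ds"
    using d assms by (intro cycles_commute) auto
  ultimately show ?thesis by (simp add: Un_commute)
next
  case False
  then have "length cs \<ge> 4" using assms by presburger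
  then show ?thesis using assms by (intro comm_rep_long_even_pair) auto
qed

lemma comm_rep_2_2:
  assumes "distinct cs" "length cs = 2" "distinct ds" "length ds = 2" "set cs \<inter> set ds = {}"
  shows "comm_rep (set cs \<union> set ds) True (cycle_of_list cs \<circ> cycle_of_list ds)"
proof -
  obtain b c d e where cs: "cs = [b, c]" "ds = [d, e]"
    using assms by (auto simp: numeral_eq_Suc length_Suc_conv)
  have S: "set cs \<union> set ds = {b, c, d, e}" using cs by auto
  have "distinct [b, c, d, e]" using assms cs by auto
  from comm_repI[OF comm_sol_2_2[OF this]] show ?thesis unfolding S unfolding cs .
qed

text \<open>An odd \<open>a\<close> comes from disjoint solutions for the 3-cycle and the pair, an
  even one from lengthening the fixed point in \<open>fixed_point_sol_1_2_2\<close>.\<close>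

lemma comm_rep_3_2_2:
  assumes "distinct ts" "length ts = 3" and c: "distinct cs" "length cs = 2" "distinct ds" "length ds = 2" "set cs \<inter> set ds = {}"
    and d: "set ts \<inter> (set cs \<union> set ds) = {}"
  shows "comm_rep (set ts \<union> (set cs \<union> set ds)) e (cycle_of_list ts \<circ> (cycle_of_list cs \<circ> cycle_of_list ds))"
proof (cases e)
  case True
  obtain b c b' c' where cs: "cs = [b, c]" "ds = [b', c']"
    using assms by (auto simp: numeral_eq_Suc length_Suc_conv)
  have S: "set cs \<union> set ds = {b, c, b', c'}" using cs by auto
  have "distinct [b, c, b', c']" using assms cs by auto
  then have f: "fixed_point_sol (set cs \<union> set ds) (cycle_of_list cs \<circ> cycle_of_list ds) 0 False"
    unfolding S unfolding cs by (rule fixed_point_sol_1_2_2)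
  have w: "(cycle_of_list cs \<circ> cycle_of_list ds) permutes (set cs \<union> set ds)"
    by (intro permutes_compose cycle_of_list_permutes) auto
  show ?thesis
    using fixed_point_sol_rep[OF fixed_point_sol_iterate[OF f w, of 1] _ assms(1) d] assms(2) True by simp
next
  case False
  then show ?thesis
    using comm_rep_Un[OF comm_rep_3_cycle[OF assms(1,2)] comm_rep_2_2[OF c] d] by simp
qed

text \<open>The odd \<open>a\<close> of two separate 3-cycles multiply to an even one; odd parity is
  the explicit \<open>comm_sol_3_3\<close>.\<close>

lemma comm_rep_3_3:
  assumes "distinct cs" "length cs = 3" "distinct ds" "length ds = 3" and d: "set cs \<inter> set ds = {}"
  shows "comm_rep (set cs \<union> set ds) e (cycle_of_list cs \<circ> cycle_of_list ds)"
proof (cases e)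
  case True
  then show ?thesis
    using comm_rep_Un[OF comm_rep_3_cycle[of cs] comm_rep_3_cycle[of ds] d] assms by simp
next
  case False
  obtain b c d e f g where cs: "cs = [b, c, d]" "ds = [e, f, g]"
    using assms by (auto simp: numeral_eq_Suc length_Suc_conv)
  have S: "set cs \<union> set ds = {b, c, d, e, f, g}" using cs by auto
  have "distinct [b, c, d, e, f, g]" using assms cs by auto
  from comm_repI[OF comm_sol_3_3[OF this]] show ?thesis using False unfolding S unfolding cs by simp
qed

lemma comm_rep_id_flexible:
  assumes "card S \<ge> 2"
  shows "comm_rep S e id"
proof -
  have fin: "finite S" using assms card.infinite by fastforce
  obtain b c where "b \<in> S" "c \<in> S" "b \<noteq> c"
    using assms by (metis card_le_Suc0_iff_eq fin not_less_eq_eq numeral_2_eq_2)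
  then show ?thesis
    using comm_rep_id[OF fin] comm_repI[OF comm_sol_id_odd[OF fin]] by (cases e) auto
qed

section \<open>Assembling the cycles\<close>

text \<open>The permutations that have been put together from cycles so far. Apart from the flexible ones,
  for which the parity of \<open>a\<close> can be chosen, these are the identity on at most one point, a
  3-cycle with at most one fixed point, and permutations with a pair of 2-cycles.
  The pair is remembered because it makes a 3-cycle flexible.\<close>

inductive assembled :: "'a set \<Rightarrow> ('a \<Rightarrow> 'a) \<Rightarrow> bool" where
  flexible: "(\<And>e. comm_rep S e x) \<Longrightarrow> assembled S x"
| small: "finite S \<Longrightarrow> card S \<le> 1 \<Longrightarrow> assembled S id"
| triple: "distinct ts \<Longrightarrow> length ts = 3 \<Longrightarrow> set ts \<inter> T = {} \<Longrightarrow> finite T \<Longrightarrow> card T \<le> 1 \<Longrightarrow>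
    assembled (set ts \<union> T) (cycle_of_list ts)"
| pair: "distinct cs \<Longrightarrow> length cs = 2 \<Longrightarrow> distinct ds \<Longrightarrow> length ds = 2 \<Longrightarrow> set cs \<inter> set ds = {} \<Longrightarrow>
    (set cs \<union> set ds) \<inter> T = {} \<Longrightarrow> comm_rep T True w \<Longrightarrow>
    assembled (set cs \<union> set ds \<union> T) (cycle_of_list cs \<circ> cycle_of_list ds \<circ> w)"

lemma assembled_comm_rep:
  assumes "assembled S x"
  obtains e where "comm_rep S e x"
  using assms
proof cases
  case flexible
  then show ?thesis using that by blast
next
  case small
  then show ?thesis using comm_rep_id that by metis
next
  case (triple ts T)
  then have "comm_rep (set ts \<union> T) (False = True) (cycle_of_list ts \<circ> id)"
    by (intro comm_rep_Un comm_rep_3_cycle comm_rep_id) auto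
  then show ?thesis using that triple by simp
next
  case (pair cs ds T w)
  have "comm_rep (set cs \<union> set ds \<union> T) (True = True) (cycle_of_list cs \<circ> cycle_of_list ds \<circ> w)"
    by (intro comm_rep_Un comm_rep_2_2) (use pair in auto)
  from that[unfolded pair(1,2), OF this] show ?thesis .
qed

text \<open>In the \<open>triple\<close> case \<open>S\<close> has at most four points and in the
  \<open>small\<close> case at most one; the remaining cases admit an even \<open>a\<close>.\<close>

lemma assembled_large:
  assumes "assembled S x" "card S \<ge> 5"
  shows "comm_rep S True x"
  using assms(1)
proof cases
  case small
  then have False using assms(2) by linarith
  then show ?thesis ..
next
  case (triple ts T)
  then have "card S = 3 + card T" using distinct_card[of ts] by (simp add: card_Un_disjoint)
  then show ?thesis using triple assms(2) by simp
next
  case (pair cs ds T w)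
  have "comm_rep (set cs \<union> set ds \<union> T) (True = True) (cycle_of_list cs \<circ> cycle_of_list ds \<circ> w)"
    by (intro comm_rep_Un comm_rep_2_2) (use pair in auto)
  then show ?thesis using pair by simp
qed

lemma assembled_flexible_Un:
  assumes "\<And>e. comm_rep S e x" "assembled T w" "S \<inter> T = {}"
  shows "assembled (S \<union> T) (x \<circ> w)"
proof -
  obtain e where "comm_rep T e w" using assembled_comm_rep[OF assms(2)] .
  then show ?thesis using comm_rep_Un_left[OF assms(1) _ assms(3)] by (blast intro: flexible)
qed

lemma assembled_point:
  assumes x: "assembled S x" and c: "c \<notin> S"
  shows "assembled (insert c S) x"
  using x
proof cases
  case flexible
  have "comm_rep ({c} \<union> S) e (id \<circ> x)" for e
    by (rule comm_rep_Un_right[OF comm_rep_id flexible(1)]) (use c in auto)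
  then show ?thesis by (intro assembled.flexible) simp
next
  case small
  show ?thesis
  proof (cases "S = {}")
    case True
    then show ?thesis using small assembled.small[of "{c}"] by simp
  next
    case False
    then have "card (insert c S) \<ge> 2" using small c by (simp add: card_gt_0_iff Suc_le_eq)
    then show ?thesis unfolding small(1) by (intro assembled.flexible comm_rep_id_flexible)
  qed
next
  case (triple ts T)
  have cT: "c \<notin> T" "set ts \<inter> insert c T = {}" using triple c by auto
  show ?thesis
  proof (cases "T = {}")
    case True
    then show ?thesis using triple assembled.triple[of ts "{c}"] c by simp
  next
    case False
    \<comment> \<open>There are now two fixed points beside the 3-cycle, and their transposition can
      change the parity of \<open>a\<close>.\<close>
    then have "card (insert c T) \<ge> 2" using triple cT by (simp add: card_gt_0_iff Suc_le_eq)
    then have "comm_rep (set ts \<union> insert c T) e (cycle_of_list ts \<circ> id)" for e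
      using triple cT by (intro comm_rep_Un_right[OF comm_rep_3_cycle] comm_rep_id_flexible) auto
    then show ?thesis using triple by (intro assembled.flexible) simp
  qed
next
  case (pair cs ds T w)
  have "comm_rep ({c} \<union> T) (True = True) (id \<circ> w)"
    by (rule comm_rep_Un[OF comm_rep_id pair(9)]) (use c pair in auto)
  then have "assembled (set cs \<union> set ds \<union> insert c T) (cycle_of_list cs \<circ> cycle_of_list ds \<circ> w)"
    using pair c by (intro assembled.pair) auto
  then show ?thesis using pair by simp
qed

text \<open>A 3-cycle becomes flexible when it meets another 3-cycle or a pair of 2-cycles; next to
  at most one fixed point it is the \<open>triple\<close> case.\<close>

lemma assembled_3_cycle:
  assumes x: "assembled S x" and ts: "distinct ts" "length ts = 3" "set ts \<inter> S = {}"
  shows "assembled (set ts \<union> S) (cycle_of_list ts \<circ> x)"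
  using x
proof cases
  case flexible
  then show ?thesis
    by (intro assembled.flexible comm_rep_Un_right[OF comm_rep_3_cycle]) (use ts in auto)
next
  case small
  then show ?thesis using assembled.triple[OF ts] by simp
next
  case (triple us T)
  have "comm_rep (set ts \<union> set us \<union> T) e (cycle_of_list ts \<circ> cycle_of_list us \<circ> id)" for e
    by (rule comm_rep_Un_left[OF comm_rep_3_3 comm_rep_id]) (use ts triple in auto)
  then show ?thesis using triple by (intro assembled.flexible) (simp add: Un_assoc)
next
  case (pair cs ds T w)
  have "comm_rep (set ts \<union> (set cs \<union> set ds) \<union> T) e
      (cycle_of_list ts \<circ> (cycle_of_list cs \<circ> cycle_of_list ds) \<circ> w)" for e
    by (rule comm_rep_Un_left[OF comm_rep_3_2_2 pair(9)]) (use ts pair in auto)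
  then show ?thesis using pair by (intro assembled.flexible) (simp add: Un_assoc comp_assoc)
qed

lemma assembled_odd_cycle:
  assumes x: "assembled S x" and cs: "distinct cs" "odd (length cs)" "set cs \<inter> S = {}"
  shows "assembled (set cs \<union> S) (cycle_of_list cs \<circ> x)"
proof -
  have "length cs = 1 \<or> length cs = 3 \<or> length cs \<ge> 5" using cs(2) by presburger
  then consider "length cs = 1" | "length cs = 3" | "length cs \<ge> 5" by blast
  then show ?thesis
  proof cases
    case 1
    then obtain c where "cs = [c]" by (auto simp: length_Suc_conv)
    then show ?thesis using assembled_point[OF x, of c] cs by simp
  next
    case 2
    then show ?thesis using assembled_3_cycle[OF x] cs by blast
  next
    case 3
    then show ?thesis using assembled_flexible_Un[OF comm_rep_long_odd_cycle x] cs by blast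
  qed
qed

lemma assembled_2_2:
  assumes x: "assembled S x" and cs: "distinct cs" "length cs = 2" "distinct ds" "length ds = 2"
    "set cs \<inter> set ds = {}" and d: "(set cs \<union> set ds) \<inter> S = {}"
  shows "assembled (set cs \<union> set ds \<union> S) (cycle_of_list cs \<circ> cycle_of_list ds \<circ> x)"
  using x
proof cases
  case flexible
  then show ?thesis using assembled.pair[OF cs d] by blast
next
  case small
  then show ?thesis using assembled.pair[OF cs d] comm_rep_id by blast
next
  case (triple ts T)
  have "cycle_of_list cs \<circ> cycle_of_list ds \<circ> cycle_of_list ts =
      cycle_of_list ts \<circ> (cycle_of_list cs \<circ> cycle_of_list ds)"
    by (rule permutes_comp_commute[of _ "set cs \<union> set ds" _ "set ts"])
      (use triple d in \<open>auto intro!: permutes_compose cycle_of_list_permutes\<close>)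
  moreover have "comm_rep (set ts \<union> (set cs \<union> set ds) \<union> T) e
      (cycle_of_list ts \<circ> (cycle_of_list cs \<circ> cycle_of_list ds) \<circ> id)" for e
    by (rule comm_rep_Un_left[OF comm_rep_3_2_2 comm_rep_id]) (use triple cs d in auto)
  ultimately show ?thesis using triple by (intro assembled.flexible) (simp add: Un_ac)
next
  case (pair cs' ds' T w)
  \<comment> \<open>The old pair joins the remainder, which still has an even \<open>a\<close>; the
    new pair is the one remembered.\<close>
  have "comm_rep (set cs' \<union> set ds' \<union> T) (True = True) (cycle_of_list cs' \<circ> cycle_of_list ds' \<circ> w)"
    by (intro comm_rep_Un comm_rep_2_2) (use pair in auto)
  then show ?thesis using assembled.pair[OF cs d] pair by simp
qed

lemma assembled_even_pair:
  assumes x: "assembled S x" and cs: "distinct cs" "even (length cs)" "length cs \<ge> 2"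
    "distinct ds" "even (length ds)" "length ds \<ge> 2"
    "set cs \<inter> set ds = {}" and d: "(set cs \<union> set ds) \<inter> S = {}"
  shows "assembled (set cs \<union> set ds \<union> S) (cycle_of_list cs \<circ> cycle_of_list ds \<circ> x)"
proof (cases "length cs = 2 \<and> length ds = 2")
  case True
  then show ?thesis using assembled_2_2[OF x] cs d by blast
next
  case False
  then show ?thesis using assembled_flexible_Un[OF comm_rep_even_pair[OF cs] x d] by blast
qed

text \<open>An odd permutation is assembled up to one cycle of even length that waits for a partner.\<close>

definition half_assembled :: "'a set \<Rightarrow> ('a \<Rightarrow> 'a) \<Rightarrow> bool" where
  "half_assembled S x \<longleftrightarrow> (\<exists>ds T w. distinct ds \<and> even (length ds) \<and> length ds \<ge> 2 \<and> set ds \<inter> T = {} \<and>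
     S = set ds \<union> T \<and> x = cycle_of_list ds \<circ> w \<and> assembled T w)"

lemma assembled_even_cycle:
  assumes "assembled S x" "distinct cs" "even (length cs)" "length cs \<ge> 2" "set cs \<inter> S = {}"
  shows "half_assembled (set cs \<union> S) (cycle_of_list cs \<circ> x)"
  using assms unfolding half_assembled_def by blast

text \<open>Disjoint cycles commute, so the waiting cycle stays in front and the odd cycle is
  assembled behind it.\<close>

lemma half_assembled_odd_cycle:
  assumes "half_assembled S x" and cs: "distinct cs" "odd (length cs)" "set cs \<inter> S = {}"
  shows "half_assembled (set cs \<union> S) (cycle_of_list cs \<circ> x)"
proof -
  obtain ds T w where ds: "distinct ds" "even (length ds)" "length ds \<ge> 2" "set ds \<inter> T = {}"
    "S = set ds \<union> T" "x = cycle_of_list ds \<circ> w" "assembled T w"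
    using assms(1) unfolding half_assembled_def by blast
  have d: "set cs \<inter> set ds = {}" "set cs \<inter> T = {}" "set ds \<inter> (set cs \<union> T) = {}"
    using cs(3) ds by auto
  have "cycle_of_list cs \<circ> cycle_of_list ds = cycle_of_list ds \<circ> cycle_of_list cs"
    using cs(1) ds(1) d(1) by (rule cycles_commute)
  then have "cycle_of_list cs \<circ> x = cycle_of_list ds \<circ> (cycle_of_list cs \<circ> w)"
    unfolding ds(6) by (simp only: comp_assoc[symmetric])
  moreover have "set cs \<union> S = set ds \<union> (set cs \<union> T)" using ds(5) by auto
  moreover have "assembled (set cs \<union> T) (cycle_of_list cs \<circ> w)"
    using assembled_odd_cycle[OF ds(7) cs(1,2) d(2)] .
  ultimately show ?thesis using assembled_even_cycle[of "set cs \<union> T" "cycle_of_list cs \<circ> w" ds] ds(1-3) d(3)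
    by (simp only:)
qed

lemma half_assembled_even_cycle:
  assumes "half_assembled S x" and cs: "distinct cs" "even (length cs)" "length cs \<ge> 2" "set cs \<inter> S = {}"
  shows "assembled (set cs \<union> S) (cycle_of_list cs \<circ> x)"
proof -
  obtain ds T w where ds: "distinct ds" "even (length ds)" "length ds \<ge> 2" "set ds \<inter> T = {}"
    "S = set ds \<union> T" "x = cycle_of_list ds \<circ> w" "assembled T w"
    using assms(1) unfolding half_assembled_def by blast
  have d: "set cs \<inter> set ds = {}" "(set cs \<union> set ds) \<inter> T = {}"
    using cs(4) ds by auto
  from assembled_even_pair[OF ds(7) cs(1-3) ds(1-3) d] show ?thesis
    unfolding ds(5,6) by (simp only: Un_assoc comp_assoc)
qed

section \<open>Induction over the cycle decomposition\<close>

text \<open>A cycle is an odd permutation exactly when its length is even and positive, so the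
  parity of \<open>x\<close> tells whether a cycle of even length is still waiting for a
  partner.\<close>

lemma cycle_decomp_assembled:
  assumes "cycle_decomp S x"
  shows "finite S \<and> x permutes S \<and> (if evenperm x then assembled S x else half_assembled S x)"
  using assms
proof (induction rule: cycle_decomp.induct)
  case empty
  show "finite {} \<and> id permutes {} \<and> (if evenperm id then assembled {} id else half_assembled {} id)"
    using assembled.small[of "{}"] by simp
next
  case (comp S x cs)
  then have fin: "finite S" and x: "x permutes S"
    and IH: "if evenperm x then assembled S x else half_assembled S x" by blast+
  let ?c = "cycle_of_list cs"
  have p: "(?c \<circ> x) permutes (set cs \<union> S)"
    using x by (intro permutes_compose cycle_of_list_permutes) (auto intro: permutes_subset)
  have ev: "evenperm (?c \<circ> x) \<longleftrightarrow> evenperm ?c = evenperm x"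
    using evenperm_comp[OF permutation_of_cycle] fin x permutation_permutes by blast
  have "if evenperm (?c \<circ> x) then assembled (set cs \<union> S) (?c \<circ> x) else half_assembled (set cs \<union> S) (?c \<circ> x)"
  \<comment> \<open>\<open>cycle_decomp\<close> admits the empty list, whose length is even although
    its cycle is the identity.\<close>
  proof (cases "cs = []")
    case True
    then have "?c \<circ> x = x" "set cs \<union> S = S" by auto
    then show ?thesis using IH by (simp only:)
  next
    case False
    then have e: "evenperm ?c \<longleftrightarrow> odd (length cs)"
      using evenperm_cycle_of_list comp(2) by blast
    have "even (length cs) \<Longrightarrow> length cs \<ge> 2" using False by (cases cs; cases "tl cs") auto
    then show ?thesis
      using IH ev e comp(2,3) assembled_odd_cycle[of S x cs] assembled_even_cycle[of S x cs]
        half_assembled_odd_cycle[of S x cs] half_assembled_even_cycle[of S x cs]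
      by presburger
  qed
  then show "finite (set cs \<union> S) \<and> (?c \<circ> x) permutes (set cs \<union> S) \<and>
      (if evenperm (?c \<circ> x) then assembled (set cs \<union> S) (?c \<circ> x) else half_assembled (set cs \<union> S) (?c \<circ> x))"
    using fin p by blast
qed

lemma comm_rep_even_permutation:
  assumes "x permutes S" "evenperm x" "card S \<ge> 5"
  shows "comm_rep S True x"
proof -
  have "finite S" using assms(3) card.infinite by fastforce
  then have "assembled S x"
    using cycle_decomp_assembled[OF cycle_decomposition] assms by metis
  then show ?thesis using assms(3) by (rule assembled_large)
qed

section \<open>Transfer to the alternating group\<close>

lemma alt_group_pow:
  "x [^]\<^bsub>alt_group n\<^esub> (k :: nat) = x ^^ k"
proof (induction k)
  case (Suc k)
  have "x [^]\<^bsub>alt_group n\<^esub> Suc k = x ^^ k \<circ> x"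
    using Suc by (simp add: nat_pow_Suc alt_group_mult)
  then show ?case by (simp only: funpow_Suc_right)
qed (simp add: alt_group_one)

theorem theorem3p1:
  fixes n :: nat
  assumes "n \<ge> 5"
  shows "\<forall>x \<in> carrier (alt_group n).
    \<exists>y \<in> carrier (alt_group n). \<exists>a \<in> carrier (alt_group n).
      x = commutator (alt_group n) y a \<and>
      odd (group.ord (alt_group n) y) \<and>
      group.ord (alt_group n) a dvd 4"
proof
  fix x
  assume "x \<in> carrier (alt_group n)"
  then have "comm_rep {1..n} True x"
    using assms by (intro comm_rep_even_permutation) (auto simp: alt_group_carrier)
  then obtain y a where sol: "comm_sol {1..n} True x y a" unfolding comm_rep_def by blast
  note D = sol[unfolded comm_sol_def]
  note perm = comm_sol_permutes[OF sol]
  have y: "y \<in> carrier (alt_group n)" and a: "a \<in> carrier (alt_group n)"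
    using perm D odd_cycles_evenperm by (auto simp: alt_group_carrier)
  \<comment> \<open>Cancelling \<open>a y\<close> on the left turns the inverse-free equation of
    \<open>comm_sol\<close> back into a commutator.\<close>
  have "x = (inv' y \<circ> inv' a) \<circ> (a \<circ> y) \<circ> x"
    using permutes_inv_o(2)[OF perm(1)] permutes_inv_o(2)[OF perm(2)]
    by (simp add: fun_eq_iff)
  also have "\<dots> = (inv' y \<circ> inv' a) \<circ> (a \<circ> y \<circ> x)" by (simp only: comp_assoc)
  also have "\<dots> = inv' y \<circ> inv' a \<circ> y \<circ> a" using D by (simp add: comp_assoc)
  also have "\<dots> = commutator (alt_group n) y a"
    unfolding commutator_def alt_group_mult alt_group_inv_equality[OF y] alt_group_inv_equality[OF a] ..
  finally have "x = commutator (alt_group n) y a" .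
  moreover obtain k where "odd k" "y ^^ k = id" using odd_cycles_order D by blast
  then have "group.ord (alt_group n) y dvd k"
    using group.pow_eq_id[OF alt_group_is_group y] by (simp add: alt_group_pow alt_group_one)
  then have "odd (group.ord (alt_group n) y)" using \<open>odd k\<close> by (meson dvd_trans)
  moreover have "group.ord (alt_group n) a dvd 4"
    using group.pow_eq_id[OF alt_group_is_group a] D by (simp add: alt_group_pow alt_group_one)
  ultimately show "\<exists>y \<in> carrier (alt_group n). \<exists>a \<in> carrier (alt_group n).
      x = commutator (alt_group n) y a \<and> odd (group.ord (alt_group n) y) \<and> group.ord (alt_group n) a dvd 4"
    using y a by blast
qed

end
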